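(* Let $\mathbb{F}$ be a field and let $A$ be a strictly upper-triangular matrix of $\mathcal{M}_{Cf}(\mathbb{F})$. Then $A$ is the sum of two square-zero elements of $\mathcal{M}_{Cf}(\mathbb{F})$.
   Context: $\mathbb{N}$ is the set of non-negative integers. $\mathcal{M}_{Cf}(\mathbb{F})$ is the $\mathbb{F}$-algebra of column-finite matrices indexed over $\mathbb{N}$: families $(a_{i,j})_{(i,j)\in\mathbb{N}^2}$ of elements of $\mathbb{F}$ such that $\{i\in\mathbb{N}: a_{i,j}\neq 0\}$ is finite for all $j\in\mathbb{N}$, with entrywise linear operations and the usual matrix product. Such a matrix is strictly upper-triangular if $a_{i,j}=0$ for all $i\ge j$. An element $B$ is square-zero if $B^2=0$. *)

theory Defs
  imports Complex_Main
begin

text \<open>Column-finite matrices indexed over the natural numbers: the entry in row \<open>i\<close> and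
  column \<open>j\<close> of \<open>A\<close> is \<open>entry A i j\<close>.\<close>

typedef (overloaded) 'a cf_matrix = "{a :: nat \<Rightarrow> nat \<Rightarrow> 'a::zero. \<forall>j. finite {i. a i j \<noteq> 0}}"
  morphisms entry Abs_cf_matrix
  by (rule exI [of _ "\<lambda>_ _. 0"]) simp

setup_lifting type_definition_cf_matrix

lemma finite_column: "finite {i. entry A i j \<noteq> 0}"
  using entry [of A] by simp

lemma cf_matrix_eqI: "(\<And>i j. entry A i j = entry B i j) \<Longrightarrow> A = B"
  by (metis entry_inject ext)

instantiation cf_matrix :: (ring_1) ring_1
begin

lift_definition zero_cf_matrix :: "'a cf_matrix" is "\<lambda>_ _. 0"
  by simp

lift_definition one_cf_matrix :: "'a cf_matrix" is "\<lambda>i j. if i = j then 1 else 0"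
  by simp

lift_definition plus_cf_matrix :: "'a cf_matrix \<Rightarrow> 'a cf_matrix \<Rightarrow> 'a cf_matrix"
  is "\<lambda>a b i j. a i j + b i j"
proof -
  fix a b :: "nat \<Rightarrow> nat \<Rightarrow> 'a" and j
  assume "\<And>j. finite {i. a i j \<noteq> 0}" and "\<And>j. finite {i. b i j \<noteq> 0}"
  then have "finite ({i. a i j \<noteq> 0} \<union> {i. b i j \<noteq> 0})" by simp
  then show "finite {i. a i j + b i j \<noteq> 0}"
    by (rule rev_finite_subset) auto
qed

lift_definition uminus_cf_matrix :: "'a cf_matrix \<Rightarrow> 'a cf_matrix"
  is "\<lambda>a i j. - a i j"
  by simp

lift_definition minus_cf_matrix :: "'a cf_matrix \<Rightarrow> 'a cf_matrix \<Rightarrow> 'a cf_matrix"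
  is "\<lambda>a b i j. a i j - b i j"
proof -
  fix a b :: "nat \<Rightarrow> nat \<Rightarrow> 'a" and j
  assume "\<And>j. finite {i. a i j \<noteq> 0}" and "\<And>j. finite {i. b i j \<noteq> 0}"
  then have "finite ({i. a i j \<noteq> 0} \<union> {i. b i j \<noteq> 0})" by simp
  then show "finite {i. a i j - b i j \<noteq> 0}"
    by (rule rev_finite_subset) auto
qed

text \<open>The usual product: the sum over all \<open>k\<close> of \<open>a i k * b k j\<close> has only finitely many nonzero
  terms, namely among the \<open>k\<close> in the support of column \<open>j\<close> of \<open>b\<close>.\<close>

lift_definition times_cf_matrix :: "'a cf_matrix \<Rightarrow> 'a cf_matrix \<Rightarrow> 'a cf_matrix"
  is "\<lambda>a b i j. \<Sum>k | b k j \<noteq> 0. a i k * b k j"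
proof -
  fix a b :: "nat \<Rightarrow> nat \<Rightarrow> 'a" and j
  assume a: "\<And>j. finite {i. a i j \<noteq> 0}" and b: "\<And>j. finite {i. b i j \<noteq> 0}"
  have "{i. (\<Sum>k | b k j \<noteq> 0. a i k * b k j) \<noteq> 0} \<subseteq> (\<Union>k\<in>{k. b k j \<noteq> 0}. {i. a i k \<noteq> 0})"
  proof
    fix i
    assume "i \<in> {i. (\<Sum>k | b k j \<noteq> 0. a i k * b k j) \<noteq> 0}"
    then obtain k where "b k j \<noteq> 0" "a i k * b k j \<noteq> 0"
      by (auto elim: sum.not_neutral_contains_not_neutral)
    then show "i \<in> (\<Union>k\<in>{k. b k j \<noteq> 0}. {i. a i k \<noteq> 0})"
      by auto
  qed
  then show "finite {i. (\<Sum>k | b k j \<noteq> 0. a i k * b k j) \<noteq> 0}"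
    by (rule finite_subset) (use a b in auto)
qed

lemma entry_times_superset:
  fixes A B :: "'a cf_matrix"
  assumes "finite S" "{k. entry B k j \<noteq> 0} \<subseteq> S"
  shows "entry (A * B) i j = (\<Sum>k\<in>S. entry A i k * entry B k j)"
  unfolding times_cf_matrix.rep_eq
  by (rule sum.mono_neutral_left) (use assms in auto)

instance
proof
  fix A B C :: "'a cf_matrix"
  show "A * B * C = A * (B * C)"
  proof (rule cf_matrix_eqI)
    fix i j
    let ?S = "{k. entry C k j \<noteq> 0}"
    let ?T = "\<Union>k\<in>?S. {l. entry B l k \<noteq> 0}"
    have S: "finite ?S" by (rule finite_column)
    have T: "finite ?T" using S finite_column by blast
    have BC: "entry (B * C) l j = (\<Sum>k\<in>?S. entry B l k * entry C k j)" for l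
      by (rule entry_times_superset) (use S in auto)
    have sub: "{l. entry (B * C) l j \<noteq> 0} \<subseteq> ?T"
    proof
      fix l
      assume "l \<in> {l. entry (B * C) l j \<noteq> 0}"
      then obtain k where "k \<in> ?S" "entry B l k * entry C k j \<noteq> 0"
        unfolding BC by (auto elim: sum.not_neutral_contains_not_neutral)
      then show "l \<in> ?T" by auto
    qed
    have "entry (A * B * C) i j = (\<Sum>k\<in>?S. entry (A * B) i k * entry C k j)"
      by (rule entry_times_superset) (use S in auto)
    also have "\<dots> = (\<Sum>k\<in>?S. (\<Sum>l\<in>?T. entry A i l * entry B l k) * entry C k j)"
    proof (rule sum.cong [OF refl])
      fix k assume "k \<in> ?S"
      then have "entry (A * B) i k = (\<Sum>l\<in>?T. entry A i l * entry B l k)"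
        by (intro entry_times_superset T) auto
      then show "entry (A * B) i k * entry C k j
          = (\<Sum>l\<in>?T. entry A i l * entry B l k) * entry C k j" by simp
    qed
    also have "\<dots> = (\<Sum>l\<in>?T. \<Sum>k\<in>?S. entry A i l * entry B l k * entry C k j)"
      unfolding sum_distrib_right by (rule sum.swap)
    also have "\<dots> = (\<Sum>l\<in>?T. entry A i l * entry (B * C) l j)"
      unfolding BC sum_distrib_left by (simp add: mult.assoc)
    also have "\<dots> = entry (A * (B * C)) i j"
      by (rule entry_times_superset [symmetric, OF T sub])
    finally show "entry (A * B * C) i j = entry (A * (B * C)) i j" .
  qed
  show "1 * A = A"
  proof (rule cf_matrix_eqI)
    fix i j
    have "entry (1 * A) i j = (\<Sum>k\<in>insert i {k. entry A k j \<noteq> 0}. entry 1 i k * entry A k j)"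
      by (rule entry_times_superset) (use finite_column [of A j] in auto)
    also have "\<dots> = (\<Sum>k\<in>insert i {k. entry A k j \<noteq> 0}. if k = i then entry A i j else 0)"
      by (rule sum.cong) (auto simp: one_cf_matrix.rep_eq)
    also have "\<dots> = entry A i j"
      using finite_column [of A j] by (subst sum.delta) auto
    finally show "entry (1 * A) i j = entry A i j" .
  qed
  show "A * 1 = A"
  proof (rule cf_matrix_eqI)
    fix i j
    have "entry (A * 1) i j = (\<Sum>k\<in>{j}. entry A i k * entry 1 k j)"
      by (rule entry_times_superset) (auto simp: one_cf_matrix.rep_eq split: if_splits)
    then show "entry (A * 1) i j = entry A i j"
      by (simp add: one_cf_matrix.rep_eq)
  qed
  show "(A + B) * C = A * C + B * C"
    by (rule cf_matrix_eqI)
      (simp add: times_cf_matrix.rep_eq plus_cf_matrix.rep_eq sum.distrib distrib_right)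
  show "A * (B + C) = A * B + A * C"
  proof (rule cf_matrix_eqI)
    fix i j
    let ?S = "{k. entry B k j \<noteq> 0} \<union> {k. entry C k j \<noteq> 0}"
    have S: "finite ?S" using finite_column by blast
    have "entry (A * (B + C)) i j = (\<Sum>k\<in>?S. entry A i k * entry (B + C) k j)"
      by (rule entry_times_superset [OF S]) (auto simp: plus_cf_matrix.rep_eq)
    also have "\<dots> = (\<Sum>k\<in>?S. entry A i k * entry B k j) + (\<Sum>k\<in>?S. entry A i k * entry C k j)"
      by (simp add: plus_cf_matrix.rep_eq distrib_left sum.distrib)
    also have "(\<Sum>k\<in>?S. entry A i k * entry B k j) = entry (A * B) i j"
      by (rule entry_times_superset [symmetric, OF S]) auto
    also have "(\<Sum>k\<in>?S. entry A i k * entry C k j) = entry (A * C) i j"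
      by (rule entry_times_superset [symmetric, OF S]) auto
    finally show "entry (A * (B + C)) i j = entry (A * B + A * C) i j"
      by (simp add: plus_cf_matrix.rep_eq)
  qed
  show "(0 :: 'a cf_matrix) \<noteq> 1"
  proof
    assume "(0 :: 'a cf_matrix) = 1"
    then have "entry (0 :: 'a cf_matrix) 0 0 = entry 1 0 0" by simp
    then show False by (simp add: zero_cf_matrix.rep_eq one_cf_matrix.rep_eq)
  qed
qed (transfer; simp add: fun_eq_iff algebra_simps)+

end

definition strictly_upper_triangular :: "'a::zero cf_matrix \<Rightarrow> bool" where
  "strictly_upper_triangular A \<longleftrightarrow> (\<forall>i j. i \<ge> j \<longrightarrow> entry A i j = 0)"

definition square_zero :: "'a::ring_1 \<Rightarrow> bool" where
  "square_zero B \<longleftrightarrow> B ^ 2 = 0"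

end

theory Submission
  imports Defs "HOL-Computational_Algebra.Polynomial"
begin

text \<open>Let \<open>A\<close> act on the space \<open>V\<close> of finitely supported columns. If \<open>V = U0 \<oplus> U1\<close> with \<open>A\<close>
  exchanging \<open>U0\<close> and \<open>U1\<close>, and \<open>P\<close>, \<open>Q\<close> are the two projections, then \<open>P A P = Q A Q = 0\<close>, so
  \<open>A = A P + A Q\<close> is a sum of two square-zero matrices. The grading is built by adjoining one
  basis vector at a time to a finite-dimensional graded \<open>A\<close>-stable subspace, in the style of the
  Kaplansky--Mackey proof of Ulm's theorem: the graded subspace is required to be compatible with
  the (transfinite) heights of \<open>V\<close> as a torsion module over the polynomial ring, and a vector \<open>x\<close>
  with homogeneous \<open>A x\<close> and of maximal height in its coset can be adjoined as a homogeneous element.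
  In general \<open>A x = z0 + z1\<close>; one first adjoins a homogeneous preimage \<open>y\<close> of one of the
  \<open>z\<close>'s, and then \<open>x - y\<close>.\<close>

section \<open>Comparison of Ulm heights under an endomorphism\<close>

locale vector_space_endo = vector_space scale
  for scale :: "'a::field \<Rightarrow> 'v::ab_group_add \<Rightarrow> 'v" +
  fixes u :: "'v \<Rightarrow> 'v"
  assumes u_add: "u (x + y) = u x + u y"
    and u_scale: "u (scale c x) = scale c (u x)"
begin

lemma u_0 [simp]: "u 0 = 0"
  using u_add[of 0 0] by simp

lemma u_minus: "u (- x) = - u x"
  using u_add[of x "- x"] by (simp add: eq_neg_iff_add_eq_0 add.commute)

lemma u_diff: "u (x - y) = u x - u y"
  using u_add[of x "- y"] by (simp add: u_minus)

text \<open>\<open>higher x y\<close> says that the Ulm height of \<open>x\<close> exceeds that of \<open>y\<close>, where the height is the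
  largest ordinal \<open>\<alpha>\<close> with \<open>x\<close> in the \<open>\<alpha>\<close>-th iterated image of \<open>u\<close>, or infinity; no ordinals
  are needed.\<close>

inductive higher :: "'v \<Rightarrow> 'v \<Rightarrow> bool" where
  "u x' = x \<Longrightarrow> (\<And>y'. u y' = y \<Longrightarrow> higher x' y') \<Longrightarrow> higher x y"

text \<open>As the negation of a least fixed point this is a greatest one: every chain of preimages
  of \<open>x\<close> can be matched by one of \<open>y\<close>. Hence infinite heights compare as
  equal, and inequalities can be proved by coinduction.\<close>

definition le :: "'v \<Rightarrow> 'v \<Rightarrow> bool" (infix "\<preceq>" 50) where
  "x \<preceq> y \<longleftrightarrow> \<not> higher x y"

lemma not_le [simp]: "\<not> x \<preceq> y \<longleftrightarrow> higher x y"
  by (simp add: le_def)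

lemma le_iff: "x \<preceq> y \<longleftrightarrow> (\<forall>x'. u x' = x \<longrightarrow> (\<exists>y'. u y' = y \<and> x' \<preceq> y'))"
  unfolding le_def by (subst higher.simps) blast

lemma le_preimage:
  assumes "u x \<preceq> z"
  obtains y where "u y = z" "x \<preceq> y"
  using assms le_iff by blast

lemma le_coinduct [consumes 1]:
  assumes "S x y" and "\<And>x y. S (u x) y \<Longrightarrow> \<exists>y'. u y' = y \<and> S x y'"
  shows "x \<preceq> y"
proof -
  have "\<not> S x y" if "higher x y" for x y
    using that by induction (use assms(2) in blast)
  then show ?thesis using assms(1) le_def by blast
qed

text \<open>If both held, the witnessing preimages of \<open>x\<close> and \<open>y\<close> would
  each be higher than the other, which the induction hypothesis excludes. Totality of the height
  order rests on this.\<close>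

lemma higher_asym: "higher x y \<Longrightarrow> \<not> higher y x"
proof (induction rule: higher.induct)
  case (1 x' x y)
  then show ?case by (metis higher.cases)
qed

lemma higher_imp_le: "higher x y \<Longrightarrow> y \<preceq> x"
  using higher_asym le_def by blast

lemma le_total: "x \<preceq> y \<or> y \<preceq> x"
  using higher_imp_le not_le by blast

lemma le_refl [simp]: "x \<preceq> x"
  using le_total by blast

lemma le_trans [trans]:
  assumes "x \<preceq> y" "y \<preceq> z" shows "x \<preceq> z"
proof -
  have "\<exists>y. x \<preceq> y \<and> y \<preceq> z" using assms by blast
  then show ?thesis
  proof (rule le_coinduct)
    fix x z
    assume "\<exists>y. u x \<preceq> y \<and> y \<preceq> z"
    then show "\<exists>z'. u z' = z \<and> (\<exists>y. x \<preceq> y \<and> y \<preceq> z')"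
      by (metis le_preimage)
  qed
qed

lemma higher_le_trans [trans]: "higher x y \<Longrightarrow> z \<preceq> y \<Longrightarrow> higher x z"
  using le_trans not_le by blast

lemma le_higher_trans [trans]: "x \<preceq> y \<Longrightarrow> higher x z \<Longrightarrow> higher y z"
  using le_trans not_le by blast

text \<open>Preimages of the summands add up to a preimage of the sum. Together with
  \<open>le_scale\<close>, this makes the vectors of height at least that of \<open>x\<close> a
  subspace.\<close>

lemma le_add:
  assumes "x \<preceq> y" "x \<preceq> z" shows "x \<preceq> y + z"
proof -
  have "\<exists>y' z'. y + z = y' + z' \<and> x \<preceq> y' \<and> x \<preceq> z'" using assms by blast
  then show ?thesis
  proof (rule le_coinduct)
    fix x w
    assume "\<exists>y z. w = y + z \<and> u x \<preceq> y \<and> u x \<preceq> z"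
    then show "\<exists>w'. u w' = w \<and> (\<exists>y z. w' = y + z \<and> x \<preceq> y \<and> x \<preceq> z)"
      by (metis le_preimage u_add)
  qed
qed

lemma le_scale:
  assumes "x \<preceq> y" shows "x \<preceq> scale c y"
proof -
  have "\<exists>y'. scale c y = scale c y' \<and> x \<preceq> y'" using assms by blast
  then show ?thesis
  proof (rule le_coinduct)
    fix x w
    assume "\<exists>y. w = scale c y \<and> u x \<preceq> y"
    then show "\<exists>w'. u w' = w \<and> (\<exists>y. w' = scale c y \<and> x \<preceq> y)"
      by (metis le_preimage u_scale)
  qed
qed

lemma le_0 [simp]: "x \<preceq> 0"
  using le_scale[of x x 0] by simp

lemma le_diff: "x \<preceq> y \<Longrightarrow> x \<preceq> z \<Longrightarrow> x \<preceq> y - z"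
  using le_add[of x y "- z"] le_scale[of x z "-1"] by simp

lemma higher_add:
  assumes "higher x v" "higher y v" shows "higher (x + y) v"
  using assms le_total[of x y] by (meson le_add le_higher_trans le_refl)

lemma higher_diff:
  assumes "higher x v" "higher y v" shows "higher (x - y) v"
  using assms le_total[of x y] by (meson le_diff le_higher_trans le_refl)

lemma scale_le: "c \<noteq> 0 \<Longrightarrow> x \<preceq> y \<Longrightarrow> scale c x \<preceq> y"
proof -
  assume "c \<noteq> 0" "x \<preceq> y"
  have "scale c x \<preceq> scale (inverse c) (scale c x)" by (rule le_scale) simp
  then show ?thesis using \<open>c \<noteq> 0\<close> \<open>x \<preceq> y\<close> le_trans by simp
qed

text \<open>A termination argument: each failure of \<open>P\<close> leads strictly above a height
  represented in \<open>R\<close>, so the number of elements of \<open>R\<close> at or above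
  \<open>v\<close> drops.\<close>

lemma ex_maximal_height:
  assumes "finite R" "T \<noteq> {}"
    and step: "\<And>v. v \<in> T \<Longrightarrow> \<not> P v \<Longrightarrow> \<exists>v'\<in>T. higher v' v \<and> (\<exists>r\<in>R. v \<preceq> r \<and> r \<preceq> v)"
  shows "\<exists>v\<in>T. P v"
proof -
  let ?c = "\<lambda>v. card {r \<in> R. v \<preceq> r}"
  obtain v where v: "v \<in> T" "\<And>v'. v' \<in> T \<Longrightarrow> ?c v \<le> ?c v'"
    using \<open>T \<noteq> {}\<close> ex_has_least_nat[of "\<lambda>v. v \<in> T" _ ?c] by blast
  have "P v"
  proof (rule ccontr)
    assume "\<not> P v"
    then obtain v' r where v': "v' \<in> T" "higher v' v" and r: "r \<in> R" "v \<preceq> r" "r \<preceq> v"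
      using step v(1) by blast
    have "r \<notin> {r \<in> R. v' \<preceq> r}" using r v'(2) higher_le_trans by auto
    moreover have "{r \<in> R. v' \<preceq> r} \<subseteq> {r \<in> R. v \<preceq> r}"
      using v'(2) higher_imp_le le_trans by blast
    ultimately have "{r \<in> R. v' \<preceq> r} \<subset> {r \<in> R. v \<preceq> r}" using r by blast
    then have "?c v' < ?c v" using \<open>finite R\<close> by (intro psubset_card_mono) auto
    then show False using v(2)[OF v'(1)] by simp
  qed
  then show ?thesis using v(1) by blast
qed

section \<open>Graded subspaces compatible with heights\<close>

text \<open>The last conjunct (finitely many heights) replaces finite dimension.\<close>

definition good :: "'v set \<Rightarrow> 'v set \<Rightarrow> bool" where
  "good W0 W1 \<longleftrightarrow> subspace W0 \<and> subspace W1 \<and> W0 \<inter> W1 = {0} \<and> u ` W0 \<subseteq> W1 \<and> u ` W1 \<subseteq> W0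
    \<and> (\<forall>a\<in>W0. \<forall>b\<in>W1. a + b \<preceq> a)
    \<and> (\<exists>R. finite R \<and> (\<forall>a\<in>W0. \<forall>b\<in>W1. a + b \<noteq> 0 \<longrightarrow> (\<exists>r\<in>R. a + b \<preceq> r \<and> r \<preceq> a + b)))"

text \<open>Properness in the sense of Kaplansky and Mackey: maximal height in the coset modulo
  \<open>W0 + W1\<close>.\<close>

definition proper :: "'v set \<Rightarrow> 'v set \<Rightarrow> 'v \<Rightarrow> bool" where
  "proper W0 W1 x \<longleftrightarrow> (\<forall>a\<in>W0. \<forall>b\<in>W1. x + (a + b) \<preceq> x)"

lemma good_0: "good {0} {0}"
  by (auto simp: good_def subspace_def intro: exI[of _ "{}"])

text \<open>The component \<open>b\<close> is the difference of \<open>a + b\<close> and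
  \<open>a\<close>, both at least as high as \<open>a + b\<close>. So the height of a sum is exactly
  the minimum of the heights of its components.\<close>

lemma good_le2:
  assumes "good W0 W1" "a \<in> W0" "b \<in> W1" shows "a + b \<preceq> b"
  using le_diff[of "a + b" "a + b" a] assms by (simp add: good_def)


lemma proper_swap: "proper W0 W1 x \<Longrightarrow> proper W1 W0 x"
  unfolding proper_def by (subst add.commute) blast

lemma good_le1: "good W0 W1 \<Longrightarrow> a \<in> W0 \<Longrightarrow> b \<in> W1 \<Longrightarrow> a + b \<preceq> a"
  by (simp add: good_def)

lemma good_heights:
  assumes "good W0 W1"
  obtains R where "finite R"
    "\<And>a b. a \<in> W0 \<Longrightarrow> b \<in> W1 \<Longrightarrow> a + b \<noteq> 0 \<Longrightarrow> \<exists>r\<in>R. a + b \<preceq> r \<and> r \<preceq> a + b"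
proof -
  have "\<exists>R. finite R \<and> (\<forall>a\<in>W0. \<forall>b\<in>W1. a + b \<noteq> 0 \<longrightarrow> (\<exists>r\<in>R. a + b \<preceq> r \<and> r \<preceq> a + b))"
    using assms by (simp add: good_def)
  then show ?thesis using that by metis
qed

lemma good_swap:
  assumes g: "good W0 W1" shows "good W1 W0"
proof -
  obtain R where R: "finite R"
    "\<And>a b. a \<in> W0 \<Longrightarrow> b \<in> W1 \<Longrightarrow> a + b \<noteq> 0 \<Longrightarrow> \<exists>r\<in>R. a + b \<preceq> r \<and> r \<preceq> a + b"
    using good_heights[OF g] by blast
  show ?thesis
    unfolding good_def
  proof (intro conjI)
    show "\<forall>b\<in>W1. \<forall>a\<in>W0. b + a \<preceq> b"
    proof (intro ballI)
      fix a b assume "a \<in> W0" "b \<in> W1"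
      then show "b + a \<preceq> b" using good_le2[OF g] by (subst add.commute)
    qed
    have "\<exists>r\<in>R. b + a \<preceq> r \<and> r \<preceq> b + a" if "a \<in> W0" "b \<in> W1" "b + a \<noteq> 0" for a b
      using R(2)[of a b] that by (simp add: add.commute[of b a])
    then show "\<exists>R. finite R \<and> (\<forall>b\<in>W1. \<forall>a\<in>W0. b + a \<noteq> 0 \<longrightarrow> (\<exists>r\<in>R. b + a \<preceq> r \<and> r \<preceq> b + a))"
      using R(1) by blast
  qed (use g in \<open>auto simp: good_def\<close>)
qed

text \<open>Up to a nonzero scalar, a new vector is \<open>x + (a + b)\<close>. As \<open>x\<close>
  is proper, its height is the minimum of those of \<open>x\<close> and \<open>a + b\<close>; this
  gives compatibility, and \<open>x\<close> contributes at most one new height.\<close>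

lemma good_adjoin:
  assumes g: "good W0 W1" and p: "proper W0 W1 x" and ux: "u x \<in> W1"
    and x: "\<And>a b. a \<in> W0 \<Longrightarrow> b \<in> W1 \<Longrightarrow> x \<noteq> a + b"
  shows "good (span (insert x W0)) W1"
proof -
  have s: "subspace W0" "subspace W1" using g by (auto simp: good_def)
  have br: "v \<in> span (insert x W0) \<Longrightarrow> \<exists>a\<in>W0. \<exists>c. v = a + scale c x" for v
    using span_breakdown_eq[of v x W0] s(1) by (metis add_diff_cancel_left' diff_add_cancel span_eq_iff)
  have norm: "a + scale c x + b = scale c (x + (scale (inverse c) a + scale (inverse c) b))"
    if "c \<noteq> 0" for a b c using that by (simp add: scale_right_distrib algebra_simps)
  have sc: "scale c a \<in> W0" if "a \<in> W0" for a c using s that by (simp add: subspace_scale)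
  have sc1: "scale c a \<in> W1" if "a \<in> W1" for a c using s that by (simp add: subspace_scale)
  have 1: "span (insert x W0) \<inter> W1 = {0}"
  proof -
    have "v = 0" if v: "v \<in> span (insert x W0)" "v \<in> W1" for v
    proof -
      obtain a c where ac: "a \<in> W0" "v = a + scale c x" using br v by blast
      have "c = 0"
      proof (rule ccontr)
        assume c: "c \<noteq> 0"
        have "x = scale (inverse c) (v - a)" using ac c by simp
        also have "\<dots> = scale (- inverse c) a + scale (inverse c) v"
          by (simp add: scale_right_diff_distrib)
        finally show False using x sc[OF ac(1)] sc1[OF v(2)] by blast
      qed
      then show ?thesis using ac v g by (auto simp: good_def)
    qed
    then show ?thesis using s subspace_0 by (auto simp: span_zero)
  qed
  have 2: "u ` span (insert x W0) \<subseteq> W1"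
  proof
    fix w assume "w \<in> u ` span (insert x W0)"
    then obtain a c where "a \<in> W0" "w = u a + scale c (u x)" using br u_add u_scale by fastforce
    moreover have "u a \<in> W1" using g \<open>a \<in> W0\<close> by (auto simp: good_def)
    ultimately show "w \<in> W1" using ux sc1 s subspace_add by blast
  qed
  have 3: "u ` W1 \<subseteq> span (insert x W0)"
    using g unfolding good_def by (metis insertCI span_base subset_iff)
  have 4: "v + b \<preceq> v" if v: "v \<in> span (insert x W0)" "b \<in> W1" for v b
  proof -
    obtain a c where ac: "a \<in> W0" "v = a + scale c x" using br v by blast
    show ?thesis
    proof (cases "c = 0")
      case True then show ?thesis using ac v g by (simp add: good_def)
    next
      case False
      let ?a = "scale (inverse c) a" and ?b = "scale (inverse c) b"
      have m: "?a \<in> W0" "?b \<in> W1" using sc sc1 ac v by auto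
      have xx: "x + (?a + ?b) \<preceq> x" using p m by (simp add: proper_def)
      have "x + (?a + ?b) \<preceq> x + (?a + ?b) - x" by (rule le_diff[OF le_refl xx])
      then have "x + (?a + ?b) \<preceq> ?a + ?b" by simp
      then have "x + (?a + ?b) \<preceq> ?a" using good_le1[OF g m] le_trans by blast
      then have "x + (?a + ?b) \<preceq> x + ?a" using xx le_add by blast
      then have "scale c (x + (?a + ?b)) \<preceq> scale c (x + ?a)" using False le_scale scale_le by blast
      then show ?thesis using norm[OF False, of a b] norm[OF False, of a 0] ac by simp
    qed
  qed
  obtain R where R: "finite R"
    "\<And>a b. a \<in> W0 \<Longrightarrow> b \<in> W1 \<Longrightarrow> a + b \<noteq> 0 \<Longrightarrow> \<exists>r\<in>R. a + b \<preceq> r \<and> r \<preceq> a + b"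
    using good_heights[OF g] by blast
  have 5: "\<exists>r\<in>insert x R. v + b \<preceq> r \<and> r \<preceq> v + b"
    if v: "v \<in> span (insert x W0)" "b \<in> W1" "v + b \<noteq> 0" for v b
  proof -
    obtain a c where ac: "a \<in> W0" "v = a + scale c x" using br v by blast
    show ?thesis
    proof (cases "c = 0")
      case True then show ?thesis using ac v R(2) by simp
    next
      case False
      let ?a = "scale (inverse c) a" and ?b = "scale (inverse c) b"
      have m: "?a \<in> W0" "?b \<in> W1" using sc sc1 ac v by auto
      have xx: "x + (?a + ?b) \<preceq> x" using p m by (simp add: proper_def)
      have "\<exists>r\<in>insert x R. x + (?a + ?b) \<preceq> r \<and> r \<preceq> x + (?a + ?b)"
      proof (cases "x \<preceq> ?a + ?b")
        case True
        then show ?thesis using xx le_add le_refl by blast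
      next
        case h: False
        then have "?a + ?b \<preceq> x" using higher_imp_le by simp
        then have q: "?a + ?b \<preceq> x + (?a + ?b)" using le_add le_refl by blast
        have "x + (?a + ?b) \<preceq> x + (?a + ?b) - x" by (rule le_diff[OF le_refl xx])
        then have q': "x + (?a + ?b) \<preceq> ?a + ?b" by simp
        have "?a + ?b \<noteq> 0" using h by (metis le_0)
        then obtain r where "r \<in> R" "?a + ?b \<preceq> r" "r \<preceq> ?a + ?b" using R(2)[OF m] by blast
        then show ?thesis using q q' le_trans by blast
      qed
      then obtain r where "r \<in> insert x R" "x + (?a + ?b) \<preceq> r" "r \<preceq> x + (?a + ?b)" by blast
      then have "scale c (x + (?a + ?b)) \<preceq> r \<and> r \<preceq> scale c (x + (?a + ?b))"
        using False le_scale scale_le by blast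
      then show ?thesis using norm[OF False, of a b] ac \<open>r \<in> insert x R\<close> by metis
    qed
  qed
  show ?thesis
    unfolding good_def
  proof (intro conjI)
    show "\<exists>R. finite R \<and> (\<forall>a\<in>span (insert x W0). \<forall>b\<in>W1. a + b \<noteq> 0 \<longrightarrow>
        (\<exists>r\<in>R. a + b \<preceq> r \<and> r \<preceq> a + b))"
      by (rule exI[of _ "insert x R"]) (use R(1) 5 in simp)
  qed (use 1 2 3 4 s subspace_span in simp_all)
qed

text \<open>A summand \<open>w\<close> that raises the height of \<open>x\<close> must have the
  height of \<open>x\<close>. For \<open>w\<close> in \<open>W0 + W1\<close> this leaves finitely
  many heights at which an ascent can start.\<close>

lemma higher_add_self:
  assumes "higher (x + w) x" shows "x \<preceq> w" "w \<preceq> x" "w \<noteq> 0"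
proof -
  show "x \<preceq> w" using le_diff[of x "x + w" x] higher_imp_le[OF assms] by simp
  show "w \<preceq> x" using higher_diff[OF assms, of w] by (metis add_diff_cancel_right' le_def le_refl)
  show "w \<noteq> 0" using assms by (metis add.right_neutral le_def le_refl)
qed

text \<open>By \<open>higher_add_self\<close>, any ascent within \<open>T\<close> starts at one of
  the finitely many heights of \<open>W0 + W1\<close>.\<close>

lemma ex_max_coset:
  assumes g: "good W0 W1" and T: "T \<noteq> {}"
    and d: "\<And>v v'. v \<in> T \<Longrightarrow> v' \<in> T \<Longrightarrow> \<exists>a\<in>W0. \<exists>b\<in>W1. v' = v + (a + b)"
  shows "\<exists>v\<in>T. \<forall>v'\<in>T. v' \<preceq> v"
proof -
  obtain R where R: "finite R"
    "\<And>a b. a \<in> W0 \<Longrightarrow> b \<in> W1 \<Longrightarrow> a + b \<noteq> 0 \<Longrightarrow> \<exists>r\<in>R. a + b \<preceq> r \<and> r \<preceq> a + b"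
    using good_heights[OF g] by blast
  show ?thesis
  proof (rule ex_maximal_height[OF R(1) T])
    fix v assume v: "v \<in> T" "\<not> (\<forall>v'\<in>T. v' \<preceq> v)"
    then obtain v' where v': "v' \<in> T" "higher v' v" by auto
    then obtain a b where ab: "a \<in> W0" "b \<in> W1" "v' = v + (a + b)" using d v by blast
    then have "v \<preceq> a + b" "a + b \<preceq> v" "a + b \<noteq> 0" using higher_add_self v'(2) by blast+
    then show "\<exists>v'\<in>T. higher v' v \<and> (\<exists>r\<in>R. v \<preceq> r \<and> r \<preceq> v)"
      using R(2)[OF ab(1,2)] v' le_trans by meson
  qed
qed

section \<open>Enlarging the graded subspace to contain a given vector\<close>

definition extends :: "'v set \<Rightarrow> 'v set \<Rightarrow> 'v \<Rightarrow> bool" where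
  "extends W0 W1 x \<longleftrightarrow> (\<exists>W0' W1'. W0 \<subseteq> W0' \<and> W1 \<subseteq> W1' \<and> good W0' W1'
     \<and> (\<exists>a\<in>W0'. \<exists>b\<in>W1'. x = a + b))"

lemma extends_swap: "extends W1 W0 x \<Longrightarrow> extends W0 W1 x"
  unfolding extends_def by (metis add.commute good_swap)

lemma extends_proper:
  assumes g: "good W0 W1" and p: "proper W0 W1 x" and ux: "u x \<in> W1"
  shows "extends W0 W1 x"
proof (cases "\<exists>a\<in>W0. \<exists>b\<in>W1. x = a + b")
  case True
  then show ?thesis using g unfolding extends_def by blast
next
  case False
  have "good (span (insert x W0)) W1" by (rule good_adjoin[OF g p ux]) (use False in blast)
  moreover have "0 \<in> W1" using g by (simp add: good_def subspace_0)
  ultimately show ?thesis unfolding extends_def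
    by (metis add.right_neutral insert_iff order_refl span_base subsetI)
qed

lemma extends_trans:
  assumes g: "W0 \<subseteq> W0'" "W1 \<subseteq> W1'" "good W0' W1'" and y: "a \<in> W0'" "b \<in> W1'"
    and e: "extends W0' W1' (x - (a + b))"
  shows "extends W0 W1 x"
proof -
  obtain V0 V1 c d where *: "W0' \<subseteq> V0" "W1' \<subseteq> V1" "good V0 V1" "c \<in> V0" "d \<in> V1"
      "x - (a + b) = c + d"
    using e unfolding extends_def by blast
  then have "x = (a + c) + (b + d)" by (simp add: algebra_simps)
  moreover have "a + c \<in> V0" "b + d \<in> V1" using * y by (auto simp: good_def intro: subspace_add)
  moreover have "W0 \<subseteq> V0" "W1 \<subseteq> V1" using *(1,2) g(1,2) by auto
  ultimately show ?thesis unfolding extends_def using *(3) by blast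
qed

text \<open>Maximality of the height of \<open>z\<close> in its coset makes every failure of properness of a
  preimage of \<open>z\<close> produce a higher preimage; the finitely many heights of \<open>W0 + W1\<close> bound this
  process, also when the height of \<open>z\<close> is a limit.\<close>

lemma ex_homogeneous_preimage:
  assumes g: "good W0 W1" and z: "z \<in> W1" and y: "u y = z" "higher y x"
  obtains W0' y' where "W0 \<subseteq> W0'" "good W0' W1" "y' \<in> W0'" "u y' = z" "higher y' x"
    "\<And>v. v \<in> W0' \<Longrightarrow> \<exists>a\<in>W0. \<exists>c. v = a + scale c y'"
proof -
  have s: "subspace W0" "subspace W1" and odd: "\<And>a. a \<in> W0 \<Longrightarrow> u a \<in> W1" "\<And>a. a \<in> W1 \<Longrightarrow> u a \<in> W0"
    using g by (auto simp: good_def)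
  \<comment> \<open>A correction \<open>w\<close> higher than \<open>x\<close> keeps
    \<open>y + w\<close> higher than \<open>x\<close> and changes the target from \<open>z\<close>
    to \<open>z + u w\<close>; the highest such target is chosen.\<close>
  let ?T = "{z + u a | a. a \<in> W0 \<and> higher a x}"
  have "\<exists>v\<in>?T. \<forall>v'\<in>?T. v' \<preceq> v"
  proof (rule ex_max_coset[OF g])
    have "higher 0 x" using y(2) le_0 le_higher_trans by blast
    then show "?T \<noteq> {}" using s subspace_0 by blast
    fix v v' assume "v \<in> ?T" "v' \<in> ?T"
    then obtain a a' where *: "a \<in> W0" "v = z + u a" "a' \<in> W0" "v' = z + u a'" by blast
    then have "v' = v + (0 + (u a' - u a))" by simp
    moreover have "u a' - u a \<in> W1" using * odd s by (simp add: subspace_diff)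
    ultimately show "\<exists>a\<in>W0. \<exists>b\<in>W1. v' = v + (a + b)" using s subspace_0 by blast
  qed
  then obtain w where w: "w \<in> W0" "higher w x"
    and max: "\<And>a. a \<in> W0 \<Longrightarrow> higher a x \<Longrightarrow> z + u a \<preceq> z + u w" by blast
  let ?z = "z + u w"
  let ?Y = "{v. u v = ?z \<and> higher v x}"
  have zW: "?z \<in> W1" using z w odd s by (simp add: subspace_add)
  have "\<exists>y\<in>?Y. proper W0 W1 y"
  proof -
    obtain R where R: "finite R"
      "\<And>a b. a \<in> W0 \<Longrightarrow> b \<in> W1 \<Longrightarrow> a + b \<noteq> 0 \<Longrightarrow> \<exists>r\<in>R. a + b \<preceq> r \<and> r \<preceq> a + b"
      using good_heights[OF g] by blast
    show ?thesis
    proof (rule ex_maximal_height[OF R(1)])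
      have "y + w \<in> ?Y" using y w u_add higher_add by simp
      then show "?Y \<noteq> {}" by blast
      fix v assume v: "v \<in> ?Y" "\<not> proper W0 W1 v"
      then obtain a b where ab: "a \<in> W0" "b \<in> W1" and h: "higher (v + (a + b)) v"
        unfolding proper_def by auto
      note hs = higher_add_self[OF h]
      have "v \<preceq> a" using hs(1) good_le1[OF g ab] le_trans by blast
      then have "higher a x" using v le_higher_trans by blast
      then have wa: "w + a \<in> W0" "higher (w + a) x" using w ab s higher_add by (auto simp: subspace_add)
      \<comment> \<open>The term \<open>u b\<close> lies in \<open>W0\<close> and the rest in
        \<open>W1\<close>, so dropping \<open>u b\<close> does not lower the height; nor does
        replacing the rest by the maximal \<open>?z\<close>.\<close>
      have "u (v + (a + b)) = u b + (z + u (w + a))" using v by (simp add: u_add algebra_simps)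
      also have "\<dots> \<preceq> z + u (w + a)"
        using good_le2[OF g] odd ab wa z s by (simp add: subspace_add)
      also have "\<dots> \<preceq> ?z" using max wa by blast
      finally obtain v' where v': "u v' = ?z" "v + (a + b) \<preceq> v'" by (rule le_preimage)
      have "higher v' v" using v'(2) h le_higher_trans by blast
      moreover have "higher v' x" using v \<open>higher v' v\<close> higher_imp_le le_higher_trans by blast
      ultimately show "\<exists>v'\<in>?Y. higher v' v \<and> (\<exists>r\<in>R. v \<preceq> r \<and> r \<preceq> v)"
        using R(2)[OF ab hs(3)] hs(1,2) v' le_trans by blast
    qed
  qed
  then obtain v where v: "u v = ?z" "higher v x" "proper W0 W1 v" by blast
  show ?thesis
  proof (cases "\<exists>a\<in>W0. \<exists>b\<in>W1. v = a + b")
    case True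
    then obtain a b where ab: "a \<in> W0" "b \<in> W1" "v = a + b" by blast
    \<comment> \<open>Here \<open>u b\<close> lies in both \<open>W1\<close> and \<open>W0\<close>,
      hence vanishes, and \<open>a\<close> alone is a preimage of \<open>?z\<close>.\<close>
    have "u b = ?z - u a" using v(1) ab(3) by (metis add_diff_cancel_left' u_add)
    then have "u b \<in> W1" using zW odd ab s by (simp add: subspace_diff)
    then have "u b = 0" using odd(2)[OF ab(2)] g by (auto simp: good_def)
    then have "u (a - w) = z" using v ab by (simp add: u_add u_diff)
    moreover have "higher (a - w) x"
      using good_le1[OF g ab(1,2)] v ab w le_higher_trans higher_diff by blast
    moreover have "a - w \<in> W0" using ab w s by (simp add: subspace_diff)
    moreover have "\<exists>c\<in>W0. \<exists>d. t = c + scale d (a - w)" if "t \<in> W0" for t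
      using that by (metis add.right_neutral scale_zero_left)
    ultimately show ?thesis using that[of W0 "a - w"] g by blast
  next
    case False
    let ?W = "span (insert v W0)"
    have G: "good ?W W1" by (rule good_adjoin[OF g v(3)]) (use v zW False in auto)
    have m: "w \<in> ?W" "v \<in> ?W" using w by (auto simp: span_base)
    \<comment> \<open>Subtracting \<open>w\<close> turns the preimage of \<open>?z\<close> back into
      one of \<open>z\<close>.\<close>
    have 1: "v - w \<in> ?W" by (rule span_diff[OF m(2,1)])
    have 2: "u (v - w) = z" using v by (simp add: u_diff)
    have 3: "higher (v - w) x" using v w higher_diff by blast
    have 4: "\<exists>a\<in>W0. \<exists>c. t = a + scale c (v - w)" if t: "t \<in> ?W" for t
    proof -
      obtain k where "t - scale k v \<in> W0" using t span_breakdown_eq[of t v W0] s span_eq_iff by metis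
      then have "t - scale k v + scale k w \<in> W0" using w s by (simp add: subspace_add subspace_scale)
      moreover have "t = (t - scale k v + scale k w) + scale k (v - w)"
        by (simp add: scale_right_diff_distrib)
      ultimately show ?thesis by blast
    qed
    have "W0 \<subseteq> ?W" by (auto intro: span_base)
    then show ?thesis by (rule that[OF _ G 1 2 3 4])
  qed
qed

text \<open>Since \<open>y\<close> is higher than \<open>x\<close>, adjoining it does not destroy properness of \<open>x\<close>.\<close>

lemma extends_higher_preimage:
  assumes g: "good W0 W1" and p: "proper W0 W1 x" and z: "z0 \<in> W0" "z1 \<in> W1" "u x = z0 + z1"
    and y: "u y = z1" "higher y x"
  shows "extends W0 W1 x"
proof -
  obtain W0' y' where W: "W0 \<subseteq> W0'" "good W0' W1" "y' \<in> W0'" "u y' = z1" "higher y' x"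
    and dec: "\<And>v. v \<in> W0' \<Longrightarrow> \<exists>a\<in>W0. \<exists>c. v = a + scale c y'"
    using ex_homogeneous_preimage[OF g z(2) y] by blast
  \<comment> \<open>The components are interchanged because \<open>x - y'\<close> maps to
    \<open>z0\<close> and is therefore adjoined on the side of \<open>W1\<close>.\<close>
  have "proper W1 W0' (x - y')"
    unfolding proper_def
  proof (intro ballI)
    fix b v assume b: "b \<in> W1" and "v \<in> W0'"
    then obtain a c where a: "a \<in> W0" "v = a + scale c y'" using dec by blast
    have "x - y' + (b + v) \<preceq> x"
    proof (rule ccontr)
      assume "\<not> ?thesis"
      then have "higher (x - y' + (b + v)) x" by simp
      \<comment> \<open>Adding this vector cancels all multiples of \<open>y'\<close> and leaves an
        element of the coset of \<open>x\<close> modulo \<open>W0 + W1\<close>.\<close>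
      moreover have "higher (y' - scale c y') x"
        using W(5) le_scale[OF le_refl] le_higher_trans higher_diff by blast
      ultimately have "higher ((x - y' + (b + v)) + (y' - scale c y')) x" by (rule higher_add)
      moreover have "(x - y' + (b + v)) + (y' - scale c y') = x + (a + b)" using a by simp
      ultimately have "higher (x + (a + b)) x" by metis
      then show False using p a b unfolding proper_def le_def by blast
    qed
    moreover have "x \<preceq> x - y'" using W(5) le_diff le_refl higher_imp_le by blast
    ultimately show "x - y' + (b + v) \<preceq> x - y'" using le_trans by blast
  qed
  moreover have "u (x - y') \<in> W0'" using z W by (auto simp: u_diff)
  ultimately have "extends W1 W0' (x - y')" by (rule extends_proper[OF good_swap[OF W(2)]])
  then have "extends W0' W1 (x - (y' + 0))" using extends_swap by simp
  moreover have "0 \<in> W1" using g by (simp add: good_def subspace_0)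
  ultimately show ?thesis using extends_trans W(1-3) by blast
qed

lemma extends_coset:
  assumes "good W0 W1" "a \<in> W0" "b \<in> W1" and "extends W0 W1 (x + (a + b))"
  shows "extends W0 W1 x"
proof (rule extends_trans)
  show "- a \<in> W0" "- b \<in> W1" using assms by (auto simp: good_def subspace_neg)
qed (use assms in \<open>simp_all add: algebra_simps\<close>)

lemma ex_proper:
  assumes g: "good W0 W1"
  obtains a b where "a \<in> W0" "b \<in> W1" "proper W0 W1 (x + (a + b))"
proof -
  have s: "subspace W0" "subspace W1" using g by (auto simp: good_def)
  let ?T = "{x + (a + b) | a b. a \<in> W0 \<and> b \<in> W1}"
  have "\<exists>v\<in>?T. \<forall>v'\<in>?T. v' \<preceq> v"
  proof (rule ex_max_coset[OF g])
    show "?T \<noteq> {}" using s subspace_0 by blast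
    fix v v' assume "v \<in> ?T" "v' \<in> ?T"
    then obtain a b a' b' where *: "a \<in> W0" "b \<in> W1" "v = x + (a + b)"
       "a' \<in> W0" "b' \<in> W1" "v' = x + (a' + b')" by blast
    then have "v' = v + ((a' - a) + (b' - b))" by simp
    then show "\<exists>a\<in>W0. \<exists>b\<in>W1. v' = v + (a + b)" using * s subspace_diff by blast
  qed
  then obtain a b where ab: "a \<in> W0" "b \<in> W1"
    and max: "\<And>a' b'. a' \<in> W0 \<Longrightarrow> b' \<in> W1 \<Longrightarrow> x + (a' + b') \<preceq> x + (a + b)" by blast
  have "proper W0 W1 (x + (a + b))"
    unfolding proper_def
  proof (intro ballI)
    fix c d assume "c \<in> W0" "d \<in> W1"
    then have "x + ((a + c) + (b + d)) \<preceq> x + (a + b)" using ab s max by (simp add: subspace_add)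
    then show "x + (a + b) + (c + d) \<preceq> x + (a + b)" by (simp add: algebra_simps)
  qed
  then show ?thesis using that ab by blast
qed

text \<open>Corrections at least as high as \<open>x\<close> can be added to \<open>x\<close>
  without lowering it. Choosing one with highest resulting image component provides the maximality
  hypotheses of \<open>extends_maximal_image\<close>.\<close>

lemma ex_max_image:
  assumes g: "good W0 W1" and z: "z \<in> W1"
  obtains a where "a \<in> W0" "x \<preceq> a"
    "\<And>a'. a' \<in> W0 \<Longrightarrow> x \<preceq> a' \<Longrightarrow> z + u a + u a' \<preceq> z + u a"
proof -
  have s: "subspace W0" "subspace W1" and odd: "\<And>a. a \<in> W0 \<Longrightarrow> u a \<in> W1"
    using g by (auto simp: good_def)
  let ?T = "{z + u a | a. a \<in> W0 \<and> x \<preceq> a}"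
  have "\<exists>v\<in>?T. \<forall>v'\<in>?T. v' \<preceq> v"
  proof (rule ex_max_coset[OF g])
    show "?T \<noteq> {}" using s subspace_0 le_0 by blast
    fix v v' assume "v \<in> ?T" "v' \<in> ?T"
    then obtain a a' where *: "a \<in> W0" "v = z + u a" "a' \<in> W0" "v' = z + u a'" by blast
    then have "v' = v + (0 + (u a' - u a))" by simp
    moreover have "u a' - u a \<in> W1" using * odd s by (simp add: subspace_diff)
    ultimately show "\<exists>a\<in>W0. \<exists>b\<in>W1. v' = v + (a + b)" using s subspace_0 by blast
  qed
  then obtain a where a: "a \<in> W0" "x \<preceq> a"
    and max: "\<And>a'. a' \<in> W0 \<Longrightarrow> x \<preceq> a' \<Longrightarrow> z + u a' \<preceq> z + u a" by blast
  have "z + u a + u a' \<preceq> z + u a" if "a' \<in> W0" "x \<preceq> a'" for a'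
    using max[of "a + a'"] that a s by (simp add: subspace_add le_add u_add add.assoc)
  then show ?thesis using that a by blast
qed

text \<open>The remaining case: no preimage of \<open>z0\<close> or \<open>z1\<close> is higher than \<open>x\<close>. A preimage \<open>y\<close> of \<open>z1\<close>
  as high as \<open>x\<close> is then proper, since a higher \<open>y + (a + b)\<close> would give a higher preimage of \<open>z1\<close>
  by maximality of \<open>z1\<close>; the same argument with \<open>z0\<close> shows that \<open>x - y\<close> is proper.\<close>

lemma extends_maximal_image:
  assumes g: "good W0 W1" and z: "z0 \<in> W0" "z1 \<in> W1" "u x = z0 + z1"
    and max0: "\<And>b. b \<in> W1 \<Longrightarrow> x \<preceq> b \<Longrightarrow> z0 + u b \<preceq> z0"
    and max1: "\<And>a. a \<in> W0 \<Longrightarrow> x \<preceq> a \<Longrightarrow> z1 + u a \<preceq> z1"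
    and low0: "\<And>y. u y = z0 \<Longrightarrow> y \<preceq> x"
    and low1: "\<And>y. u y = z1 \<Longrightarrow> y \<preceq> x"
  shows "extends W0 W1 x"
proof -
  have s: "subspace W0" "subspace W1"
    and odd: "\<And>a. a \<in> W0 \<Longrightarrow> u a \<in> W1" "\<And>a. a \<in> W1 \<Longrightarrow> u a \<in> W0"
    using g by (auto simp: good_def)
  \<comment> \<open>Compatibility makes \<open>z1\<close> at least as high as \<open>u x\<close>, so
    it has a preimage at least as high as \<open>x\<close>.\<close>
  have "u x \<preceq> z1" using good_le2[OF g z(1,2)] z(3) by simp
  then obtain y where y: "u y = z1" "x \<preceq> y" by (rule le_preimage)
  have yp: "proper W0 W1 y"
    unfolding proper_def
  proof (intro ballI, rule ccontr)
    fix a b assume ab: "a \<in> W0" "b \<in> W1" and "\<not> y + (a + b) \<preceq> y"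
    then have h: "higher (y + (a + b)) y" by simp
    have "x \<preceq> a"
      using y(2) higher_add_self(1)[OF h] good_le1[OF g ab] le_trans by blast
    have "u (y + (a + b)) = u b + (z1 + u a)" using y by (simp add: u_add algebra_simps)
    also have "\<dots> \<preceq> z1 + u a" using good_le2[OF g] odd ab z s by (simp add: subspace_add)
    also have "\<dots> \<preceq> z1" using max1 ab \<open>x \<preceq> a\<close> by blast
    finally obtain v where "u v = z1" "y + (a + b) \<preceq> v" by (rule le_preimage)
    then have "y + (a + b) \<preceq> y" using low1 y(2) le_trans by blast
    then show False using h le_def by blast
  qed
  obtain W0' y' where W: "W0 \<subseteq> W0'" "good W0' W1" "y' \<in> W0'" "u y' = z1" "x \<preceq> y'"
    and dec: "\<And>v. v \<in> W0' \<Longrightarrow> \<exists>a\<in>W0. \<exists>c. v = a + scale c y'"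
  proof (cases "\<exists>a\<in>W0. \<exists>b\<in>W1. y = a + b")
    case True
    then obtain a b where ab: "a \<in> W0" "b \<in> W1" "y = a + b" by blast
    have "u b = z1 - u a" using y(1) ab(3) by (metis add_diff_cancel_left' u_add)
    then have "u b \<in> W1" using z odd ab s by (simp add: subspace_diff)
    then have "u b = 0" using odd(2)[OF ab(2)] g by (auto simp: good_def)
    then have "u a = z1" using y ab by (simp add: u_add)
    moreover have "x \<preceq> a" using good_le1[OF g ab(1,2)] y ab le_trans by blast
    moreover have "\<exists>c\<in>W0. \<exists>d. t = c + scale d a" if "t \<in> W0" for t
      using that by (metis add.right_neutral scale_zero_left)
    ultimately show ?thesis using that[of W0 a] g ab by blast
  next
    case False
    let ?W = "span (insert y W0)"
    have G: "good ?W W1" by (rule good_adjoin[OF g yp]) (use y z False in auto)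
    have dec: "\<exists>a\<in>W0. \<exists>c. t = a + scale c y" if t: "t \<in> ?W" for t
      using t span_breakdown_eq[of t y W0] s span_eq_iff by (metis diff_add_cancel)
    have "W0 \<subseteq> ?W" "y \<in> ?W" by (auto intro: span_base)
    then show ?thesis by (rule that[OF _ G _ y dec])
  qed
  have "proper W1 W0' (x - y')"
    unfolding proper_def
  proof (intro ballI, rule ccontr)
    fix b v assume b: "b \<in> W1" and "v \<in> W0'" and "\<not> x - y' + (b + v) \<preceq> x - y'"
    then obtain a c where a: "a \<in> W0" "v = a + scale c y'" using dec by blast
    have h: "higher (x - y' + (b + v)) (x - y')" using \<open>\<not> _\<close> by simp
    have xy: "x \<preceq> x - y'" using W(5) le_diff le_refl by blast
    have "x \<preceq> b + v" using higher_add_self(1)[OF h] xy le_trans by blast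
    moreover have "b + v - scale c y' = a + b" using a by simp
    ultimately have "x \<preceq> a + b" using le_diff[OF _ le_scale[OF W(5)], of "b + v" c] by metis
    then have "x \<preceq> b" using good_le2[OF g a(1) b] le_trans by blast
    \<comment> \<open>Dropping the \<open>W1\<close> component does not lower the height, and
      \<open>max0\<close> then removes \<open>u b\<close>. The resulting preimage of
      \<open>z0\<close> is bounded by \<open>low0\<close>.\<close>
    have "u (x - y' + (b + v)) = (z0 + u b) + (scale c z1 + u a)"
      using z W a by (simp add: u_add u_diff u_scale algebra_simps)
    also have "\<dots> \<preceq> z0 + u b"
      by (rule good_le1[OF g]) (use z odd a b s in \<open>auto simp: subspace_add subspace_scale\<close>)
    also have "\<dots> \<preceq> z0" using max0 b \<open>x \<preceq> b\<close> by blast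
    finally obtain w where "u w = z0" "x - y' + (b + v) \<preceq> w" by (rule le_preimage)
    then have "x - y' + (b + v) \<preceq> x - y'" using low0[of w] xy le_trans by metis
    then show False using h le_def by blast
  qed
  moreover have "u (x - y') \<in> W0'" using z W by (auto simp: u_diff)
  ultimately have "extends W1 W0' (x - y')" by (rule extends_proper[OF good_swap[OF W(2)]])
  then have "extends W0' W1 (x - (y' + 0))" using extends_swap by simp
  then show ?thesis using s(2) subspace_0
    by (intro extends_trans[OF W(1) order_refl W(2,3)]) auto
qed

text \<open>The vector \<open>x\<close> may be changed modulo \<open>W0 + W1\<close>. It is first
  made proper; then corrections \<open>c\<close>, \<open>d\<close>, no lower than it, make both
  components of its image maximal while preserving height and properness. The cases are whether one
  of these components has a preimage higher than the corrected vector.\<close>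

lemma extends_if_image:
  assumes g: "good W0 W1" and z: "z0 \<in> W0" "z1 \<in> W1" "u x = z0 + z1"
  shows "extends W0 W1 x"
proof -
  have s: "subspace W0" "subspace W1"
    and odd: "\<And>a. a \<in> W0 \<Longrightarrow> u a \<in> W1" "\<And>a. a \<in> W1 \<Longrightarrow> u a \<in> W0"
    using g by (auto simp: good_def)
  obtain a b where ab: "a \<in> W0" "b \<in> W1" and p: "proper W0 W1 (x + (a + b))"
    by (rule ex_proper[OF g])
  let ?x = "x + (a + b)"
  have zW: "z0 + u b \<in> W0" "z1 + u a \<in> W1" using z ab odd s by (auto simp: subspace_add)
  obtain c where c: "c \<in> W0" "?x \<preceq> c"
    and maxc: "\<And>a'. a' \<in> W0 \<Longrightarrow> ?x \<preceq> a' \<Longrightarrow> z1 + u a + u c + u a' \<preceq> z1 + u a + u c"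
    using ex_max_image[OF g zW(2), of ?x] by blast
  obtain d where d: "d \<in> W1" "?x \<preceq> d"
    and maxd: "\<And>b'. b' \<in> W1 \<Longrightarrow> ?x \<preceq> b' \<Longrightarrow> z0 + u b + u d + u b' \<preceq> z0 + u b + u d"
    using ex_max_image[OF good_swap[OF g] zW(1), of ?x] by blast
  let ?y = "?x + (c + d)"
  let ?z0 = "z0 + u b + u d" and ?z1 = "z1 + u a + u c"
  have xy: "?x \<preceq> ?y" using c d by (simp add: le_add)
  have yx: "?y \<preceq> ?x" using p c d unfolding proper_def by blast
  have yp: "proper W0 W1 ?y"
    unfolding proper_def
  proof (intro ballI)
    fix a' b' assume "a' \<in> W0" "b' \<in> W1"
    then have "?x + ((c + a') + (d + b')) \<preceq> ?x"
      using p c d s unfolding proper_def by (simp add: subspace_add)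
    then have "?y + (a' + b') \<preceq> ?x" by (simp add: algebra_simps)
    then show "?y + (a' + b') \<preceq> ?y" using xy le_trans by blast
  qed
  have z': "?z0 \<in> W0" "?z1 \<in> W1" "u ?y = ?z0 + ?z1"
    by (rule subspace_add[OF s(1) zW(1) odd(2)[OF d(1)]])
      (rule subspace_add[OF s(2) zW(2) odd(1)[OF c(1)]], simp add: z(3) u_add algebra_simps)
  have "extends W0 W1 ?y"
  proof (cases "\<exists>y. u y = ?z1 \<and> higher y ?y")
    case True
    then show ?thesis using extends_higher_preimage[OF g yp z'] by blast
  next
    case f1: False
    show ?thesis
    proof (cases "\<exists>y. u y = ?z0 \<and> higher y ?y")
      case True
      have "u ?y = ?z1 + ?z0" using z'(3) by (simp add: add.commute)
      then have "extends W1 W0 ?y"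
        using True extends_higher_preimage[OF good_swap[OF g] proper_swap[OF yp] z'(2,1)] by blast
      then show ?thesis by (rule extends_swap)
    next
      case f0: False
      show ?thesis
      proof (rule extends_maximal_image[OF g z'])
        show "?z0 + u b' \<preceq> ?z0" if "b' \<in> W1" "?y \<preceq> b'" for b'
          using maxd[OF that(1) le_trans[OF xy that(2)]] .
        show "?z1 + u a' \<preceq> ?z1" if "a' \<in> W0" "?y \<preceq> a'" for a'
          using maxc[OF that(1) le_trans[OF xy that(2)]] .
        show "v \<preceq> ?y" if "u v = ?z0" for v using f0 that not_le by blast
        show "v \<preceq> ?y" if "u v = ?z1" for v using f1 that not_le by blast
      qed
    qed
  qed
  then have "extends W0 W1 ?x" by (rule extends_coset[OF g c(1) d(1)])
  then show ?thesis by (rule extends_coset[OF g ab])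
qed

section \<open>Exhausting the basis by a chain of graded subspaces\<close>

theorem ex_odd_grading:
  fixes e :: "nat \<Rightarrow> 'v"
  assumes ue: "\<And>n. u (e n) \<in> span (e ` {..<n})"
  obtains U0 U1 where "subspace U0" "subspace U1" "U0 \<inter> U1 = {0}" "u ` U0 \<subseteq> U1" "u ` U1 \<subseteq> U0"
    "\<And>n. \<exists>a\<in>U0. \<exists>b\<in>U1. e n = a + b"
proof -
  let ?S = "\<lambda>W. {a + b | a b. a \<in> fst W \<and> b \<in> snd W}"
  let ?P = "\<lambda>n W. good (fst W) (snd W) \<and> e ` {..<n} \<subseteq> ?S W"
  let ?Q = "\<lambda>n W V. fst W \<subseteq> fst V \<and> snd W \<subseteq> snd V"
  have "\<exists>f. \<forall>n. ?P n (f n) \<and> ?Q n (f n) (f (Suc n))"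
  proof (rule dependent_nat_choice)
    show "\<exists>W. ?P 0 W" using good_0 by auto
    fix W n assume P: "?P n W"
    obtain W0 W1 where [simp]: "W = (W0, W1)" by fastforce
    have g: "good W0 W1" using P by simp
    \<comment> \<open>Stage \<open>n\<close> contains the span of the earlier basis vectors, hence
      the image of \<open>e n\<close>, as \<open>extends_if_image\<close> requires.\<close>
    have "subspace (?S W)" using g subspace_sums[of W0 W1] by (simp add: good_def)
    then have "span (e ` {..<n}) \<subseteq> ?S W" using P span_minimal by blast
    then have "u (e n) \<in> ?S W" using ue by blast
    then obtain z0 z1 where "z0 \<in> W0" "z1 \<in> W1" "u (e n) = z0 + z1" by auto
    then have "extends W0 W1 (e n)" using extends_if_image[OF g] by blast
    then obtain V0 V1 where V: "W0 \<subseteq> V0" "W1 \<subseteq> V1" "good V0 V1" "\<exists>a\<in>V0. \<exists>b\<in>V1. e n = a + b"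
      unfolding extends_def by blast
    have "?S W \<subseteq> ?S (V0, V1)" using V by auto
    with conjunct2[OF P] have "e ` {..<n} \<subseteq> ?S (V0, V1)" by (rule subset_trans)
    moreover have "e n \<in> ?S (V0, V1)" using V(4) by auto
    ultimately have "insert (e n) (e ` {..<n}) \<subseteq> ?S (V0, V1)" by (rule insert_subsetI[rotated])
    moreover have "e ` {..<Suc n} = insert (e n) (e ` {..<n})" by (simp add: lessThan_Suc)
    ultimately have "e ` {..<Suc n} \<subseteq> ?S (V0, V1)" by (simp only:)
    with V(3) have "?P (Suc n) (V0, V1)" by simp
    moreover have "?Q n W (V0, V1)" using V(1,2) by simp
    ultimately have "?P (Suc n) (V0, V1) \<and> ?Q n W (V0, V1)" by (rule conjI)
    then show "\<exists>V. ?P (Suc n) V \<and> ?Q n W V" by (rule exI[of _ "(V0, V1)"])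
  qed
  then obtain f where F: "\<forall>n. ?P n (f n) \<and> ?Q n (f n) (f (Suc n))" ..
  have f: "?P n (f n)" "?Q n (f n) (f (Suc n))" for n
    using F[rule_format, of n] by (rule conjunct1, rule conjunct2)
  have mono: "fst (f m) \<subseteq> fst (f n)" "snd (f m) \<subseteq> snd (f n)" if "m \<le> n" for m n
    using lift_Suc_mono_le[of "\<lambda>n. fst (f n)" m n] lift_Suc_mono_le[of "\<lambda>n. snd (f n)" m n] f(2) that
    by simp_all
  let ?U0 = "\<Union>n. fst (f n)" and ?U1 = "\<Union>n. snd (f n)"
  have sub: "subspace (\<Union>n. F n)" if "\<And>n. subspace (F n)" "\<And>m n. m \<le> n \<Longrightarrow> F m \<subseteq> F n" for F :: "nat \<Rightarrow> 'v set"
    unfolding subspace_def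
  proof (intro conjI ballI allI)
    show "0 \<in> (\<Union>n. F n)" using that(1) subspace_0 by blast
    fix x assume "x \<in> (\<Union>n. F n)"
    then obtain m where m: "x \<in> F m" by blast
    show "scale c x \<in> (\<Union>n. F n)" for c using subspace_scale[OF that(1) m] by blast
    fix y assume "y \<in> (\<Union>n. F n)"
    then obtain n where "y \<in> F n" by blast
    then have "x \<in> F (max m n)" "y \<in> F (max m n)" using m that(2) by (meson max.cobounded1 max.cobounded2 subsetD)+
    then show "x + y \<in> (\<Union>n. F n)" using subspace_add[OF that(1)] by blast
  qed
  have gf: "subspace (fst (f n))" "subspace (snd (f n))" "fst (f n) \<inter> snd (f n) = {0}"
    "u ` fst (f n) \<subseteq> snd (f n)" "u ` snd (f n) \<subseteq> fst (f n)" for n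
    using f(1)[of n] unfolding good_def by blast+
  show ?thesis
  proof (rule that)
    show s: "subspace ?U0" "subspace ?U1" by (rule sub[OF gf(1) mono(1)], assumption, rule sub[OF gf(2) mono(2)])
    have "x = 0" if U: "x \<in> ?U0 \<inter> ?U1" for x
    proof -
      obtain m n where x: "x \<in> fst (f m)" "x \<in> snd (f n)" using U by auto
      have "x \<in> fst (f (max m n)) \<inter> snd (f (max m n))"
        using x mono(1)[of m "max m n"] mono(2)[of n "max m n"] by auto
      then show ?thesis using gf(3) by simp
    qed
    moreover have "0 \<in> ?U0 \<inter> ?U1" by (rule IntI) (rule s[THEN subspace_0])+
    ultimately show "?U0 \<inter> ?U1 = {0}" by (intro set_eqI) (metis singleton_iff)
    show "u ` ?U0 \<subseteq> ?U1" unfolding image_UN by (rule UN_mono) (rule subset_refl, rule gf(4))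
    show "u ` ?U1 \<subseteq> ?U0" unfolding image_UN by (rule UN_mono) (rule subset_refl, rule gf(5))
    fix n
    \<comment> \<open>Stage \<open>n\<close> covers only the indices below \<open>n\<close>, so
      \<open>e n\<close> is found at stage \<open>Suc n\<close>.\<close>
    have "e n \<in> ?S (f (Suc n))" by (rule subsetD[OF conjunct2[OF f(1)]]) simp
    then obtain a b where ab: "e n = a + b" "a \<in> fst (f (Suc n))" "b \<in> snd (f (Suc n))" by auto
    show "\<exists>a\<in>?U0. \<exists>b\<in>?U1. e n = a + b"
    proof (rule bexI[of _ a], rule bexI[of _ b])
      show "e n = a + b" by (rule ab(1))
      show "b \<in> ?U1" using ab(3) by auto
      show "a \<in> ?U0" using ab(2) by auto
    qed
  qed
qed

end

section \<open>Column-finite matrices as endomorphisms of the space of columns\<close>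

text \<open>Polynomials serve as finitely supported columns.\<close>

definition cf_col :: "'a::comm_monoid_add cf_matrix \<Rightarrow> nat \<Rightarrow> 'a poly" where
  "cf_col X j = Abs_poly (\<lambda>i. entry X i j)"

lemma coeff_cf_col [simp]: "coeff (cf_col X j) i = entry X i j"
  unfolding cf_col_def
  by (subst Abs_poly_inverse) (use finite_column[of X j] in \<open>auto simp: MOST_iff_cofinite\<close>)

definition cf_apply :: "'a::field cf_matrix \<Rightarrow> 'a poly \<Rightarrow> 'a poly" where
  "cf_apply X p = (\<Sum>j\<le>degree p. smult (coeff p j) (cf_col X j))"

lemma cf_apply_eq:
  "degree p \<le> n \<Longrightarrow> cf_apply X p = (\<Sum>j\<le>n. smult (coeff p j) (cf_col X j))"
  unfolding cf_apply_def by (rule sum.mono_neutral_left) (auto simp: coeff_eq_0)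

lemma cf_apply_add: "cf_apply X (p + q) = cf_apply X p + cf_apply X q"
  using degree_add_le[of p "max (degree p) (degree q)" q]
  by (simp add: cf_apply_eq[where n = "max (degree p) (degree q)"] smult_add_left sum.distrib)

lemma cf_apply_smult: "cf_apply X (smult c p) = smult c (cf_apply X p)"
  by (rule poly_eqI)
    (simp add: cf_apply_eq[where n = "degree p"] degree_smult_le coeff_sum sum_distrib_left mult.assoc)

lemma cf_apply_monom: "cf_apply X (monom 1 n) = cf_col X n"
  by (simp add: cf_apply_eq[where n = n, OF degree_monom_le] if_distrib[of "\<lambda>c. smult c _"] cong: if_cong)

lemma cf_apply_one: "cf_apply 1 p = p"
proof -
  have "cf_col 1 j = monom (1::'a) j" for j
    by (rule poly_eqI) (auto simp: one_cf_matrix.rep_eq)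
  then show ?thesis
    by (simp add: cf_apply_def smult_monom poly_as_sum_of_monoms)
qed

lemma cf_apply_plus: "cf_apply (X + Y) p = cf_apply X p + cf_apply Y p"
proof -
  have "cf_col (X + Y) j = cf_col X j + cf_col Y j" for j
    by (rule poly_eqI) (simp add: plus_cf_matrix.rep_eq)
  then show ?thesis by (simp add: cf_apply_def smult_add_right sum.distrib)
qed

lemma cf_col_times: "cf_col (X * Y) j = cf_apply X (cf_col Y j)"
proof (rule poly_eqI)
  fix i
  have "entry (X * Y) i j = (\<Sum>k\<le>degree (cf_col Y j). entry X i k * entry Y k j)"
    by (rule entry_times_superset) (auto intro!: le_degree)
  then show "coeff (cf_col (X * Y) j) i = coeff (cf_apply X (cf_col Y j)) i"
    by (simp add: cf_apply_def coeff_sum mult.commute)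
qed

text \<open>Column-finiteness is automatic, since a polynomial has finitely many nonzero
  coefficients.\<close>

lemma cf_matrix_of_cols: "\<exists>X. \<forall>j. cf_col X j = p j"
proof -
  have f: "finite {i. coeff (p j) i \<noteq> 0}" for j
    using MOST_coeff_eq_0[of "p j"] by (simp add: MOST_iff_cofinite)
  have "entry (Abs_cf_matrix (\<lambda>i j. coeff (p j) i)) i j = coeff (p j) i" for i j
    by (subst Abs_cf_matrix_inverse) (use f in auto)
  then show ?thesis
    by (intro exI[of _ "Abs_cf_matrix (\<lambda>i j. coeff (p j) i)"] allI poly_eqI) simp
qed

theorem theorem1p8:
  fixes A :: "'a::field cf_matrix"
  assumes "strictly_upper_triangular A"
  shows "\<exists>B C :: 'a cf_matrix. square_zero B \<and> square_zero C \<and> A = B + C"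
proof -
  interpret V: vector_space_endo "smult :: 'a \<Rightarrow> _" "cf_apply A"
    by unfold_locales (simp_all add: smult_add_right smult_add_left cf_apply_add cf_apply_smult)
  have "cf_apply A (monom 1 n) \<in> V.span (monom 1 ` {..<n})" for n
  proof -
    have "coeff (cf_col A n) i = 0" if "n \<le> i" for i
      using assms that by (simp add: strictly_upper_triangular_def)
    then have "cf_col A n = (\<Sum>i<n. smult (entry A i n) (monom 1 i))"
      by (intro poly_eqI) (simp add: coeff_sum if_distrib not_less cong: if_cong)
    also have "\<dots> \<in> V.span (monom 1 ` {..<n})"
      by (intro V.span_sum V.span_scale V.span_base) auto
    finally show ?thesis by (simp add: cf_apply_monom)
  qed
  then obtain U0 U1 where U: "V.subspace U0" "V.subspace U1" "U0 \<inter> U1 = {0}"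
      "cf_apply A ` U0 \<subseteq> U1" "cf_apply A ` U1 \<subseteq> U0"
    and "\<And>n. \<exists>a\<in>U0. \<exists>b\<in>U1. monom 1 n = a + b"
    by (rule V.ex_odd_grading) blast
  then obtain p q where pq: "\<And>n. p n \<in> U0" "\<And>n. q n \<in> U1" "\<And>n. monom 1 n = p n + q n"
    by metis
  \<comment> \<open>The matrices of the two projections: their columns are the components of the
    basis vectors.\<close>
  obtain P Q where PQ: "\<And>j. cf_col P j = p j" "\<And>j. cf_col Q j = q j"
    using cf_matrix_of_cols by metis
  have one: "1 = P + Q"
  proof (rule cf_matrix_eqI)
    fix i j
    have "coeff (monom (1::'a) j) i = coeff (cf_col P j + cf_col Q j) i" using pq(3) PQ by simp
    then show "entry 1 i j = entry (P + Q) i j"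
      by (auto simp: one_cf_matrix.rep_eq plus_cf_matrix.rep_eq)
  qed
  have split: "cf_apply P v + cf_apply Q v = v" for v
    by (metis cf_apply_one cf_apply_plus one)
  have mem: "cf_apply P v \<in> U0" "cf_apply Q v \<in> U1" for v
    unfolding cf_apply_def using U(1,2) PQ pq by (auto intro!: V.subspace_sum V.subspace_scale)
  have P0: "cf_apply P v = 0" if "v \<in> U1" for v
  proof -
    \<comment> \<open>For \<open>v\<close> in \<open>U1\<close> the right-hand side lies in
      \<open>U1\<close>, while the left-hand side lies in \<open>U0\<close>.\<close>
    have "cf_apply P v = v - cf_apply Q v" using split[of v] by (simp add: eq_diff_eq)
    then have "cf_apply P v \<in> U1" using that mem U(2) V.subspace_diff by metis
    then show ?thesis using mem U(3) by blast
  qed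
  have Q0: "cf_apply Q v = 0" if "v \<in> U0" for v
  proof -
    have "cf_apply Q v = v - cf_apply P v" using split[of v] by (simp add: eq_diff_eq add.commute)
    then have "cf_apply Q v \<in> U0" using that mem U(1) V.subspace_diff by metis
    then show ?thesis using mem U(3) by blast
  qed
  have eq0: "X = 0" if "\<And>j. cf_col X j = 0" for X :: "'a cf_matrix"
    using that by (intro cf_matrix_eqI) (metis coeff_cf_col coeff_0 zero_cf_matrix.rep_eq)
  \<comment> \<open>Checked on columns: \<open>A\<close> sends \<open>p j\<close> into
    \<open>U1\<close>, which \<open>P\<close> annihilates, and symmetrically for
    \<open>Q\<close>.\<close>
  have "P * (A * P) = 0" "Q * (A * Q) = 0"
    using P0 Q0 U(4,5) pq(1,2) by (auto intro!: eq0 simp: cf_col_times PQ image_subset_iff)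
  then have "square_zero (A * P)" "square_zero (A * Q)"
    by (simp_all add: square_zero_def power2_eq_square mult.assoc)
  moreover have "A = A * P + A * Q"
    using one by (metis distrib_left mult.right_neutral)
  ultimately show ?thesis by blast
qed

end
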